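(* Let $n,a\ge1$ be integers, let $\mathbf{p}=(p_1,\dots,p_a)$ be a probability vector, let $\mathbb{X}=(X_1,\dots,X_n)$ where the $X_i$ are independent random variables with values in $\{1,\dots,a\}$ and distribution $\mathbf{p}$, and let $\rho_{n,a,\mathbf{p}}\in S_n$ be the riffle shuffle permutation generated from $\mathbb{X}$ by inverse shuffling. Let $S\subset\{(i,j)\in[n]\times[n]: i<j\}$. Then $$\sum_{(i,j)\in S}\mathbf{1}\big(\rho_{n,a,\mathbf{p}}(i)>\rho_{n,a,\mathbf{p}}(j)\big)=\sum_{(i,j)\in S}\mathbf{1}(X_i>X_j).$$
   Context: $[n]=\{1,\dots,n\}$ and $\mathbf{1}(\cdot)$ denotes an indicator. Inverse shuffling: assign digit $X_i$ to card $i$ of a deck of cards $1,\dots,n$, and sort the cards according to digit, preserving the relative order of cards with the same digit. Let $\sigma(i)$ be the label of the card in position $i$ after sorting. The permutation generated from $\mathbb{X}$ by inverse shuffling is $\rho_{n,a,\mathbf{p}}:=\sigma^{-1}$. Explicitly, $\rho_{n,a,\mathbf{p}}(i)=\#\{j: X_j<X_i\}+\#\{j\le i: X_j=X_i\}$. It is known that $\rho_{n,a,\mathbf{p}}$ has the riffle shuffle distribution $P_{n,a,\mathbf{p}}$ (cut the deck into $a$ consecutive piles with multinomial$(n;\mathbf{p})$ sizes and interleave the piles uniformly at random keeping each pile in order). *)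

theory Defs
  imports "HOL-Probability.Probability" "HOL-Combinatorics.Permutations"
begin

text \<open>Card labels and positions are both 1, ..., n, while list indices start at 0. The function
  \<^const>\<open>sort_key\<close> is a stable sort, so cards with the same digit keep their relative order.\<close>

definition inverse_shuffle :: "nat \<Rightarrow> (nat \<Rightarrow> nat) \<Rightarrow> nat \<Rightarrow> nat" where
  "inverse_shuffle n x i = (if i \<in> {1..n} then sort_key x [1..<Suc n] ! (i - 1) else i)"

definition riffle_perm :: "nat \<Rightarrow> (nat \<Rightarrow> nat) \<Rightarrow> nat \<Rightarrow> nat" where
  "riffle_perm n x = inv (inverse_shuffle n x)"

lemma sort_key_upt_sorted_wrt:
  "sorted_wrt (<) xs \<Longrightarrow>
     sorted_wrt (\<lambda>i j. x i < x j \<or> x i = x j \<and> i < j) (sort_key x (xs :: nat list))"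
  for x :: "nat \<Rightarrow> nat"
proof (induction xs)
  case Nil
  then show ?case by simp
next
  case (Cons i xs)
  let ?R = "\<lambda>i j. x i < x j \<or> x i = x j \<and> i < j"
  have ins: "sorted_wrt ?R (insort_key x i ys)"
    if "sorted_wrt ?R ys" "\<forall>j\<in>set ys. i < j" for ys
    using that by (induction ys) (auto simp: set_insort_key)
  show ?case
    using Cons by (auto intro!: ins)
qed

lemma inverse_shuffle_permutes: "inverse_shuffle n x permutes {1..n}"
proof (rule bij_imp_permutes)
  have "bij_betw (\<lambda>k. sort_key x [1..<Suc n] ! k) {..<n} {1..n}"
    by (rule bij_betw_nth) auto
  moreover have "bij_betw (\<lambda>i. i - 1) {1..n} {..<n}"
    by (rule bij_betw_byWitness[where f' = Suc]) auto
  ultimately have "bij_betw ((\<lambda>k. sort_key x [1..<Suc n] ! k) \<circ> (\<lambda>i. i - 1)) {1..n} {1..n}"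
    by (rule bij_betw_trans[rotated])
  then show "bij_betw (inverse_shuffle n x) {1..n} {1..n}"
    by (rule bij_betw_cong[THEN iffD1, rotated]) (auto simp: inverse_shuffle_def)
qed (auto simp: inverse_shuffle_def)

lemma riffle_perm_permutes: "riffle_perm n x permutes {1..n}"
  unfolding riffle_perm_def by (rule permutes_inv[OF inverse_shuffle_permutes])

lemma riffle_perm_explicit:
  assumes i: "i \<in> {1..n}"
  shows "riffle_perm n x i =
    card {j \<in> {1..n}. x j < x i} + card {j \<in> {1..n}. j \<le> i \<and> x j = x i}"
proof -
  define L where "L = sort_key x [1..<Suc n]"
  let ?R = "\<lambda>i j. x i < x j \<or> x i = x j \<and> i < j"
  define k where "k = riffle_perm n x i"
  have k: "k \<in> {1..n}"
    using riffle_perm_permutes i unfolding k_def by (metis permutes_in_image)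
  have len: "length L = n" and setL: "set L = {1..n}" and dist: "distinct L"
    by (auto simp: L_def)
  have "inverse_shuffle n x k = i"
    unfolding k_def riffle_perm_def
    by (metis inverse_shuffle_permutes permutes_inverses(1))
  then have ki: "L ! (k - 1) = i" using k by (simp add: inverse_shuffle_def L_def)
  have srt: "sorted_wrt ?R L"
    unfolding L_def by (rule sort_key_upt_sorted_wrt) (simp del: upt_Suc)
  have mono: "?R (L ! a) (L ! b)" if "a < b" "b < n" for a b
    using srt that len sorted_wrt_nth_less by blast
  have "{j \<in> {1..n}. x j < x i} \<union> {j \<in> {1..n}. j \<le> i \<and> x j = x i} = (!) L ` {..<k}"
  proof (intro equalityI subsetI)
    fix j assume j: "j \<in> {j \<in> {1..n}. x j < x i} \<union> {j \<in> {1..n}. j \<le> i \<and> x j = x i}"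
    then have "j \<in> set L" unfolding setL by blast
    then obtain m where m: "m < n" "L ! m = j" using len by (auto simp: in_set_conv_nth)
    have "\<not> k - 1 < m" using mono[of "k - 1" m] m ki j by auto
    then show "j \<in> (!) L ` {..<k}" using m k by force
  next
    fix j assume "j \<in> (!) L ` {..<k}"
    then obtain m where m: "m < k" "j = L ! m" by auto
    have "k - 1 < n" using k by auto
    have "j \<in> {1..n}" using m k setL len nth_mem[of m L] by auto
    moreover have "m = k - 1 \<or> m < k - 1" using m by auto
    then have "j = i \<or> ?R j i" using mono[OF _ \<open>k - 1 < n\<close>, of m] m(2) ki by metis
    ultimately show "j \<in> {j \<in> {1..n}. x j < x i} \<union> {j \<in> {1..n}. j \<le> i \<and> x j = x i}"
      by auto
  qed
  moreover have "card ((!) L ` {..<k}) = k"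
    using dist len k by (subst card_image) (auto simp: inj_on_def nth_eq_iff_index_eq)
  ultimately have "card ({j \<in> {1..n}. x j < x i} \<union> {j \<in> {1..n}. j \<le> i \<and> x j = x i}) = k"
    by simp
  then show ?thesis
    unfolding k_def[symmetric] by (subst (asm) card_Un_disjoint) auto
qed

end

theory Submission
  imports Defs
begin

text \<open>The identity is deterministic and already holds term by term. Inverse shuffling sorts the
  cards by the lexicographic order on pairs (digit, label), so \<open>riffle_perm n x i\<close> is the rank of
  card \<open>i\<close> in this order, and comparing values of the permutation is the same as comparing pairs
  (lemma \<open>riffle_perm_less_iff\<close>). For \<open>i < j\<close> the tie-break by label favours \<open>i\<close>, so card \<open>i\<close>
  lands after card \<open>j\<close> exactly when its digit is strictly larger.\<close>

text \<open>Merging the two counts of the explicit formula turns the value of the permutation into the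
  size of an initial segment, which makes its monotonicity an inclusion of sets.\<close>

lemma riffle_perm_eq_lex_rank:
  assumes "i \<in> {1..n}"
  shows "riffle_perm n x i = card {k \<in> {1..n}. x k < x i \<or> x k = x i \<and> k \<le> i}"
proof -
  have "{k \<in> {1..n}. x k < x i \<or> x k = x i \<and> k \<le> i} =
      {k \<in> {1..n}. x k < x i} \<union> {k \<in> {1..n}. k \<le> i \<and> x k = x i}"
    by auto
  then show ?thesis
    unfolding riffle_perm_explicit[OF assms] by (simp, subst card_Un_disjoint) auto
qed

text \<open>If \<open>i\<close> precedes \<open>j\<close> lexicographically, the initial segment ending at \<open>i\<close> is contained in the
  one ending at \<open>j\<close>, and \<open>j\<close> itself witnesses that the inclusion is strict.\<close>

lemma riffle_perm_lex_strict_mono: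
  assumes "i \<in> {1..n}" "j \<in> {1..n}" "x i < x j \<or> x i = x j \<and> i < j"
  shows "riffle_perm n x i < riffle_perm n x j"
proof -
  let ?B = "\<lambda>i. {k \<in> {1..n}. x k < x i \<or> x k = x i \<and> k \<le> i}"
  have "?B i \<subseteq> ?B j" using assms(3) by auto
  moreover have "j \<in> ?B j" "j \<notin> ?B i" using assms by auto
  ultimately have "?B i \<subset> ?B j" by blast
  then show ?thesis
    unfolding riffle_perm_eq_lex_rank[OF assms(1)] riffle_perm_eq_lex_rank[OF assms(2)]
    by (intro psubset_card_mono) auto
qed

text \<open>The converse direction comes from totality of the lexicographic order.\<close>

lemma riffle_perm_less_iff:
  assumes "i \<in> {1..n}" "j \<in> {1..n}"
  shows "riffle_perm n x i < riffle_perm n x j \<longleftrightarrow> x i < x j \<or> x i = x j \<and> i < j"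
  using riffle_perm_lex_strict_mono[OF assms, of x]
    riffle_perm_lex_strict_mono[OF assms(2,1), of x]
  by (metis less_asym less_irrefl linorder_neqE_nat)

theorem corollary2p3:
  fixes n a :: nat and p :: "nat \<Rightarrow> real" and M :: "'w measure"
    and X :: "nat \<Rightarrow> 'w \<Rightarrow> nat" and S :: "(nat \<times> nat) set"
  assumes "n \<ge> 1" and "a \<ge> 1"
    and "\<And>k. k \<in> {1..a} \<Longrightarrow> p k \<ge> 0" and "(\<Sum>k=1..a. p k) = 1"
    and "prob_space M"
    and "prob_space.indep_vars M (\<lambda>_. count_space {1..a}) X {1..n}"
    and "\<And>i k. i \<in> {1..n} \<Longrightarrow> k \<in> {1..a} \<Longrightarrow>
           measure M {\<omega> \<in> space M. X i \<omega> = k} = p k"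
    and "S \<subseteq> {(i, j). i \<in> {1..n} \<and> j \<in> {1..n} \<and> i < j}"
  shows "\<forall>\<omega> \<in> space M.
    (\<Sum>(i, j)\<in>S. of_bool (riffle_perm n (\<lambda>m. X m \<omega>) i > riffle_perm n (\<lambda>m. X m \<omega>) j) :: nat)
      = (\<Sum>(i, j)\<in>S. of_bool (X i \<omega> > X j \<omega>))"
proof (intro ballI sum.cong refl)
  fix \<omega> and z :: "nat \<times> nat"
  assume "z \<in> S"
  then obtain i j where z: "z = (i, j)" and ij: "i \<in> {1..n}" "j \<in> {1..n}" "i < j"
    using assms(8) by auto
  have "riffle_perm n (\<lambda>m. X m \<omega>) j < riffle_perm n (\<lambda>m. X m \<omega>) i \<longleftrightarrow> X j \<omega> < X i \<omega>"
    using riffle_perm_less_iff[OF ij(2,1), of "\<lambda>m. X m \<omega>"] ij(3) by auto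
  then show "(\<lambda>(i, j). of_bool (riffle_perm n (\<lambda>m. X m \<omega>) i > riffle_perm n (\<lambda>m. X m \<omega>) j) :: nat) z
      = (\<lambda>(i, j). of_bool (X i \<omega> > X j \<omega>)) z"
    by (simp add: z)
qed

end
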